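(* Let $(X,d)$ be a compact metric space, $\varphi$ a continuous semiflow on $X$ and $T$ an admissible function on $X$ (with respect to $\varphi$). If $f:X\to\mathbb{R}$ is a continuous potential, then the $T$-topological pressure and the classical topological pressure of $f$ coincide: $P^T(\varphi,f)=P(\varphi,f)$.
   Context: **Classical pressure.** For $\varepsilon,t>0$, a set $E\subset X$ is $(\varphi,\varepsilon,t)$-separated if for any $x,y\in E$ with $x\ne y$ there is $s\in[0,t]$ with $d(\varphi_s(x),\varphi_s(y))>\varepsilon$. Put $Z(\varphi,f,\varepsilon,t)=\sup\{\sum_{x\in E}e^{\int_0^tf(\varphi_s(x))\,ds}: E\text{ is }(\varphi,\varepsilon,t)\text{-separated}\}$, $P(\varphi,f,\varepsilon)=\limsup_{t\to+\infty}\frac1t\log Z(\varphi,f,\varepsilon,t)$ and $P(\varphi,f)=\lim_{\varepsilon\to0}P(\varphi,f,\varepsilon)$. **Admissible functions.** Let $T$ assign to each $x\in X$ a sequence $(T_n(x))_{n\in A(x)}$ of nonnegative numbers, where either $A(x)=\mathbb{N}=\{1,2,\dots\}$ or $A(x)=\{1,\dots,\ell\}$ for some $\ell\in\mathbb{N}$; put $T_0(x)=0$. $T$ is admissible with respect to a semiflow $\varphi$ if there is $\eta>0$ such that for all $x\in X$ and all $n\in\mathbb{N}$ with $n+1\in A(x)$: (1) $T_{n+1}(x)-T_n(x)\ge\eta$; (2) $T_1(\varphi_t(x))=T_n(x)-t$ if $T_{n-1}(x)<t<T_n(x)$, and $T_1(\varphi_t(x))=T_{n+1}(x)-t$ if $t=T_n(x)$.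 **$T$-topological pressure.** For $x\in X$, $t>0$ and $0<\delta<\eta/2$ let $J^T_{t,\delta}(x)=[0,t]\setminus\bigcup_{j\in A(x)}]T_j(x)-\delta,T_j(x)+\delta[$. A set $E\subset X$ is $(\varphi,T,\delta,\varepsilon,t)$-separated if for any $x,y\in E$ with $x\ne y$ there is $s\in J^T_{t,\delta}(x)$ with $d(\varphi_s(x),\varphi_s(y))>\varepsilon$. Put $$Z^T(\varphi,f,\delta,\varepsilon,t)=\sup\Big\{\sum_{x\in E}\exp\Big(\int_0^tf(\varphi_s(x))\,ds\Big): E\text{ finite and }(\varphi,T,\delta,\varepsilon,t)\text{-separated}\Big\},$$ $P^T(\varphi,f,\delta,\varepsilon)=\limsup_{t\to+\infty}\frac1t\log Z^T(\varphi,f,\delta,\varepsilon,t)$, $P^T(\varphi,f,\delta)=\lim_{\varepsilon\to0}P^T(\varphi,f,\delta,\varepsilon)$ and $P^T(\varphi,f)=\lim_{\delta\to0}P^T(\varphi,f,\delta)$. (All limits exist by monotonicity.) *)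

theory Defs
  imports "HOL-Analysis.Analysis"
begin

text \<open>
  The phase space is a set \<open>X\<close> in a metric space type, with the induced metric.  A map
  \<open>\<phi> :: real \<Rightarrow> 'a \<Rightarrow> 'a\<close> is only relevant on \<open>{0..} \<times> X\<close>.
\<close>

definition continuous_semiflow :: "'a::metric_space set \<Rightarrow> (real \<Rightarrow> 'a \<Rightarrow> 'a) \<Rightarrow> bool" where
  "continuous_semiflow X \<phi> \<longleftrightarrow>
     continuous_on ({0..} \<times> X) (\<lambda>(t, x). \<phi> t x) \<and>
     (\<forall>t\<ge>0. \<forall>x\<in>X. \<phi> t x \<in> X) \<and>
     (\<forall>x\<in>X. \<phi> 0 x = x) \<and>
     (\<forall>s\<ge>0. \<forall>t\<ge>0. \<forall>x\<in>X. \<phi> (s + t) x = \<phi> s (\<phi> t x))"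

text \<open>The logarithm with values in the extended reals, \<open>ln 0 = -\<infinity>\<close> and \<open>ln \<infinity> = \<infinity>\<close>.\<close>

definition ln_ennreal :: "ennreal \<Rightarrow> ereal" where
  "ln_ennreal z = (if z = 0 then -\<infinity> else if z = \<infinity> then \<infinity> else ereal (ln (enn2real z)))"


subsection \<open>Classical topological pressure\<close>

definition separated ::
  "'a::metric_space set \<Rightarrow> (real \<Rightarrow> 'a \<Rightarrow> 'a) \<Rightarrow> real \<Rightarrow> real \<Rightarrow> 'a set \<Rightarrow> bool" where
  "separated X \<phi> \<epsilon> t E \<longleftrightarrow>
     E \<subseteq> X \<and> (\<forall>x\<in>E. \<forall>y\<in>E. x \<noteq> y \<longrightarrow> (\<exists>s\<in>{0..t}. dist (\<phi> s x) (\<phi> s y) > \<epsilon>))"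

text \<open>
  Finiteness of \<open>E\<close> is not part of the classical definition, so the sum is an unconditional sum
  of nonnegative extended reals.
\<close>

definition Zsep ::
  "'a::metric_space set \<Rightarrow> (real \<Rightarrow> 'a \<Rightarrow> 'a) \<Rightarrow> ('a \<Rightarrow> real) \<Rightarrow> real \<Rightarrow> real \<Rightarrow> ennreal" where
  "Zsep X \<phi> f \<epsilon> t =
     (SUP E\<in>{E. separated X \<phi> \<epsilon> t E}.
        infsum (\<lambda>x. ennreal (exp (integral {0..t} (\<lambda>s. f (\<phi> s x))))) E)"

definition pressure_eps ::
  "'a::metric_space set \<Rightarrow> (real \<Rightarrow> 'a \<Rightarrow> 'a) \<Rightarrow> ('a \<Rightarrow> real) \<Rightarrow> real \<Rightarrow> ereal" where
  "pressure_eps X \<phi> f \<epsilon> =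
     Limsup at_top (\<lambda>t::real. ereal (1 / t) * ln_ennreal (Zsep X \<phi> f \<epsilon> t))"

definition pressure ::
  "'a::metric_space set \<Rightarrow> (real \<Rightarrow> 'a \<Rightarrow> 'a) \<Rightarrow> ('a \<Rightarrow> real) \<Rightarrow> ereal" where
  "pressure X \<phi> f = Lim (at_right 0) (\<lambda>\<epsilon>. pressure_eps X \<phi> f \<epsilon>)"


subsection \<open>Admissible functions\<close>

text \<open>
  The sequence at \<open>x\<close> is \<open>(T x n)\<close> for \<open>n\<close> in the index set \<open>A x\<close>, extended by \<open>T x 0 = 0\<close>;
  indices start at 1, and other values \<open>T x n\<close> are irrelevant.
\<close>

definition admissible ::
  "'a::metric_space set \<Rightarrow> (real \<Rightarrow> 'a \<Rightarrow> 'a) \<Rightarrow> ('a \<Rightarrow> nat set) \<Rightarrow> ('a \<Rightarrow> nat \<Rightarrow> real) \<Rightarrow> bool" where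
  "admissible X \<phi> A T \<longleftrightarrow>
     (\<forall>x\<in>X. (A x = {1..} \<or> (\<exists>l\<ge>1. A x = {1..l})) \<and> T x 0 = 0 \<and> (\<forall>n\<in>A x. T x n \<ge> 0)) \<and>
     (\<exists>\<eta>>0. \<forall>x\<in>X. \<forall>n\<ge>1. n + 1 \<in> A x \<longrightarrow>
        T x (n + 1) - T x n \<ge> \<eta> \<and>
        (\<forall>t. T x (n - 1) < t \<and> t < T x n \<longrightarrow> T (\<phi> t x) 1 = T x n - t) \<and>
        (\<forall>t. t = T x n \<longrightarrow> T (\<phi> t x) 1 = T x (n + 1) - t))"


subsection \<open>\<open>T\<close>-topological pressure\<close>

definition J_set ::
  "('a \<Rightarrow> nat set) \<Rightarrow> ('a \<Rightarrow> nat \<Rightarrow> real) \<Rightarrow> real \<Rightarrow> real \<Rightarrow> 'a \<Rightarrow> real set" where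
  "J_set A T \<delta> t x = {0..t} - (\<Union>j\<in>A x. {T x j - \<delta> <..< T x j + \<delta>})"

text \<open>
  The set of admissible times depends on the first point only, so the condition is not symmetric
  in \<open>x\<close> and \<open>y\<close>; it is imposed on all ordered pairs.
\<close>

definition T_separated ::
  "'a::metric_space set \<Rightarrow> (real \<Rightarrow> 'a \<Rightarrow> 'a) \<Rightarrow> ('a \<Rightarrow> nat set) \<Rightarrow> ('a \<Rightarrow> nat \<Rightarrow> real) \<Rightarrow>
     real \<Rightarrow> real \<Rightarrow> real \<Rightarrow> 'a set \<Rightarrow> bool" where
  "T_separated X \<phi> A T \<delta> \<epsilon> t E \<longleftrightarrow>
     E \<subseteq> X \<and> (\<forall>x\<in>E. \<forall>y\<in>E. x \<noteq> y \<longrightarrow> (\<exists>s\<in>J_set A T \<delta> t x. dist (\<phi> s x) (\<phi> s y) > \<epsilon>))"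

definition T_Zsep ::
  "'a::metric_space set \<Rightarrow> (real \<Rightarrow> 'a \<Rightarrow> 'a) \<Rightarrow> ('a \<Rightarrow> nat set) \<Rightarrow> ('a \<Rightarrow> nat \<Rightarrow> real) \<Rightarrow>
     ('a \<Rightarrow> real) \<Rightarrow> real \<Rightarrow> real \<Rightarrow> real \<Rightarrow> ennreal" where
  "T_Zsep X \<phi> A T f \<delta> \<epsilon> t =
     (SUP E\<in>{E. finite E \<and> T_separated X \<phi> A T \<delta> \<epsilon> t E}.
        \<Sum>x\<in>E. ennreal (exp (integral {0..t} (\<lambda>s. f (\<phi> s x)))))"

definition T_pressure_delta_eps ::
  "'a::metric_space set \<Rightarrow> (real \<Rightarrow> 'a \<Rightarrow> 'a) \<Rightarrow> ('a \<Rightarrow> nat set) \<Rightarrow> ('a \<Rightarrow> nat \<Rightarrow> real) \<Rightarrow>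
     ('a \<Rightarrow> real) \<Rightarrow> real \<Rightarrow> real \<Rightarrow> ereal" where
  "T_pressure_delta_eps X \<phi> A T f \<delta> \<epsilon> =
     Limsup at_top (\<lambda>t::real. ereal (1 / t) * ln_ennreal (T_Zsep X \<phi> A T f \<delta> \<epsilon> t))"

definition T_pressure_delta ::
  "'a::metric_space set \<Rightarrow> (real \<Rightarrow> 'a \<Rightarrow> 'a) \<Rightarrow> ('a \<Rightarrow> nat set) \<Rightarrow> ('a \<Rightarrow> nat \<Rightarrow> real) \<Rightarrow>
     ('a \<Rightarrow> real) \<Rightarrow> real \<Rightarrow> ereal" where
  "T_pressure_delta X \<phi> A T f \<delta> = Lim (at_right 0) (\<lambda>\<epsilon>. T_pressure_delta_eps X \<phi> A T f \<delta> \<epsilon>)"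

text \<open>
  The restriction \<open>\<delta> < \<eta> / 2\<close>, with \<open>\<eta>\<close> the admissibility constant, is not needed here: the
  limit only depends on arbitrarily small \<open>\<delta> > 0\<close>.
\<close>

definition T_pressure ::
  "'a::metric_space set \<Rightarrow> (real \<Rightarrow> 'a \<Rightarrow> 'a) \<Rightarrow> ('a \<Rightarrow> nat set) \<Rightarrow> ('a \<Rightarrow> nat \<Rightarrow> real) \<Rightarrow>
     ('a \<Rightarrow> real) \<Rightarrow> ereal" where
  "T_pressure X \<phi> A T f = Lim (at_right 0) (\<lambda>\<delta>. T_pressure_delta X \<phi> A T f \<delta>)"

end

theory Submission
  imports Defs
begin

text \<open>
  For \<open>t \<ge> 2\<delta>\<close>, every time \<open>s \<in> [0, t]\<close> lies within \<open>2\<delta>\<close> of the set \<open>J\<close>, because the removed intervals have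
  length \<open>2\<delta>\<close> and are disjoint once \<open>2\<delta> \<le> \<eta>\<close>.  As the semiflow moves points by at most
  \<open>\<epsilon> / 4\<close> in time \<open>2\<delta>\<close>, uniformly on the compact space, two orbits that are \<open>\<epsilon>\<close>-apart at time
  \<open>s\<close> are still \<open>\<epsilon> / 2\<close>-apart at a time of \<open>J\<close>.  Hence
  \<open>Z(\<epsilon>, t) \<le> Z\<^sup>T(\<delta>, \<epsilon> / 2, t)\<close>, while \<open>Z\<^sup>T(\<delta>, \<epsilon>, t) \<le> Z(\<epsilon>, t)\<close> holds because
  \<open>J \<subseteq> [0, t]\<close>.
\<close>

section \<open>Limits at zero of monotone functions, and exponential growth rates\<close>

lemma tendsto_at_right_0_SUP:
  fixes g :: "real \<Rightarrow> ereal"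
  assumes anti: "\<And>x y. 0 < x \<Longrightarrow> x \<le> y \<Longrightarrow> g y \<le> g x"
  shows "(g \<longlongrightarrow> (SUP x\<in>{0<..}. g x)) (at_right 0)"
proof (rule order_tendstoI)
  fix a assume "a < (SUP x\<in>{0<..}. g x)"
  then obtain y where y: "0 < y" "a < g y"
    by (auto simp: less_SUP_iff)
  have "a < g x" if "0 < x" "x < y" for x
    using anti[of x y] that y by (meson less_le_trans less_imp_le)
  then show "\<forall>\<^sub>F x in at_right 0. a < g x"
    using y(1) by (auto simp: eventually_at_right_field)
next
  fix a assume a: "(SUP x\<in>{0<..}. g x) < a"
  have "g x < a" if "0 < x" for x
    using a that by (meson SUP_upper greaterThan_iff le_less_trans)
  then show "\<forall>\<^sub>F x in at_right 0. g x < a"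
    by (auto simp: eventually_at_right_field intro: exI[of _ 1])
qed

text \<open>\<open>Lim\<close> is a description operator, so it has a usable value only once
  convergence is known. With suprema in its place, pressures are compared one \<epsilon> and
  \<delta> at a time.\<close>

lemma Lim_at_right_0_SUP:
  fixes g :: "real \<Rightarrow> ereal"
  assumes "\<And>x y. 0 < x \<Longrightarrow> x \<le> y \<Longrightarrow> g y \<le> g x"
  shows "Lim (at_right 0) g = (SUP x\<in>{0<..}. g x)"
  using tendsto_at_right_0_SUP[OF assms] by (intro tendsto_Lim) auto

lemma ln_ennreal_mono:
  assumes "a \<le> b"
  shows "ln_ennreal a \<le> ln_ennreal b"
\<comment> \<open>Outside these cases both arguments are positive and finite, so
  \<open>enn2real\<close> loses nothing.\<close>
proof (cases "a = 0 \<or> b = \<infinity>")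
  case False
  then have "a \<noteq> 0" "b \<noteq> \<infinity>" "b < top" "a \<noteq> \<infinity>" "b \<noteq> 0"
    using assms by (auto simp: top.not_eq_extremum top_unique)
  moreover from this have "0 < enn2real a" "enn2real a \<le> enn2real b"
    using assms by (auto simp: enn2real_positive_iff enn2real_mono top.not_eq_extremum
        zero_less_iff_neq_zero)
  ultimately show ?thesis by (simp add: ln_ennreal_def)
qed (use assms in \<open>auto simp: ln_ennreal_def\<close>)

text \<open>The threshold \<open>t0\<close> accommodates comparisons valid only for large times,
  such as \<open>2 * \<delta> \<le> t\<close>.\<close>

lemma Limsup_growth_mono:
  fixes Z Z' :: "real \<Rightarrow> ennreal"
  assumes "\<And>t. t \<ge> t0 \<Longrightarrow> Z t \<le> Z' t"
  shows "Limsup at_top (\<lambda>t. ereal (1 / t) * ln_ennreal (Z t))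
    \<le> Limsup at_top (\<lambda>t. ereal (1 / t) * ln_ennreal (Z' t))"
proof (rule Limsup_mono)
  show "\<forall>\<^sub>F t in at_top. ereal (1 / t) * ln_ennreal (Z t) \<le> ereal (1 / t) * ln_ennreal (Z' t)"
    \<comment> \<open>The bound \<open>0\<close> keeps the factor \<open>1 / t\<close>
      nonnegative.\<close>
    using eventually_ge_at_top[of "max t0 0"]
    by eventually_elim (auto intro!: ereal_mult_left_mono ln_ennreal_mono assms)
qed

section \<open>Monotonicity of separated sets and partition sums\<close>

lemma J_set_subset: "J_set A T \<delta> t x \<subseteq> {0..t}"
  by (auto simp: J_set_def)

lemma J_set_antimono: "\<delta> \<le> \<delta>' \<Longrightarrow> J_set A T \<delta>' t x \<subseteq> J_set A T \<delta> t x"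
  unfolding J_set_def
  by (intro Diff_mono UN_mono order_refl greaterThanLessThan_subseteq_greaterThanLessThan[THEN iffD2])
    simp_all

lemma T_separated_imp_separated:
  assumes "T_separated X \<phi> A T \<delta> \<epsilon> t E"
  shows "separated X \<phi> \<epsilon> t E"
  unfolding separated_def
proof (intro conjI ballI impI)
  show "E \<subseteq> X"
    using assms by (simp add: T_separated_def)
  fix x y assume "x \<in> E" "y \<in> E" "x \<noteq> y"
  then show "\<exists>s\<in>{0..t}. \<epsilon> < dist (\<phi> s x) (\<phi> s y)"
    using assms J_set_subset[of A T \<delta> t x] unfolding T_separated_def by blast
qed

lemma separated_mono:
  assumes "\<epsilon> \<le> \<epsilon>'" "separated X \<phi> \<epsilon>' t E"
  shows "separated X \<phi> \<epsilon> t E"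
  unfolding separated_def
proof (intro conjI ballI impI)
  show "E \<subseteq> X"
    using assms(2) by (simp add: separated_def)
  fix x y assume "x \<in> E" "y \<in> E" "x \<noteq> y"
  then show "\<exists>s\<in>{0..t}. \<epsilon> < dist (\<phi> s x) (\<phi> s y)"
    using assms le_less_trans[of \<epsilon> \<epsilon>'] unfolding separated_def by blast
qed

lemma separated_subset: "separated X \<phi> \<epsilon> t E \<Longrightarrow> F \<subseteq> E \<Longrightarrow> separated X \<phi> \<epsilon> t F"
  unfolding separated_def by (simp add: subset_iff)

lemma T_separated_mono:
  assumes "\<delta> \<le> \<delta>'" "\<epsilon> \<le> \<epsilon>'" "T_separated X \<phi> A T \<delta>' \<epsilon>' t E"
  shows "T_separated X \<phi> A T \<delta> \<epsilon> t E"
  unfolding T_separated_def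
proof (intro conjI ballI impI)
  show "E \<subseteq> X"
    using assms(3) by (simp add: T_separated_def)
  fix x y assume "x \<in> E" "y \<in> E" "x \<noteq> y"
  then obtain s where "s \<in> J_set A T \<delta>' t x" "\<epsilon>' < dist (\<phi> s x) (\<phi> s y)"
    using assms(3) unfolding T_separated_def by blast
  then show "\<exists>s\<in>J_set A T \<delta> t x. \<epsilon> < dist (\<phi> s x) (\<phi> s y)"
    using J_set_antimono[OF assms(1), of A T t x] assms(2) by (intro bexI[of _ s]) auto
qed

lemma T_Zsep_mono:
  "\<delta> \<le> \<delta>' \<Longrightarrow> \<epsilon> \<le> \<epsilon>' \<Longrightarrow> T_Zsep X \<phi> A T f \<delta>' \<epsilon>' t \<le> T_Zsep X \<phi> A T f \<delta> \<epsilon> t"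
  unfolding T_Zsep_def by (rule SUP_subset_mono) (auto intro: T_separated_mono)

text \<open>The infinite sums add nothing, since subsets of separated sets are separated.\<close>

lemma Zsep_eq_SUP_finite:
  "Zsep X \<phi> f \<epsilon> t = (SUP E\<in>{E. finite E \<and> separated X \<phi> \<epsilon> t E}.
     \<Sum>x\<in>E. ennreal (exp (integral {0..t} (\<lambda>s. f (\<phi> s x)))))"
  (is "_ = (SUP E\<in>_. sum ?w E)")
proof (rule antisym)
  show "Zsep X \<phi> f \<epsilon> t \<le> (SUP E\<in>{E. finite E \<and> separated X \<phi> \<epsilon> t E}. sum ?w E)"
    unfolding Zsep_def
  proof (rule SUP_least)
    fix E assume "E \<in> {E. separated X \<phi> \<epsilon> t E}"
    then have "separated X \<phi> \<epsilon> t F" if "F \<subseteq> E" for F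
      using separated_subset that by blast
    then show "infsum ?w E \<le> (SUP E\<in>{E. finite E \<and> separated X \<phi> \<epsilon> t E}. sum ?w E)"
      by (subst nonneg_infsum_complete) (auto intro!: SUP_subset_mono)
  qed
  show "(SUP E\<in>{E. finite E \<and> separated X \<phi> \<epsilon> t E}. sum ?w E) \<le> Zsep X \<phi> f \<epsilon> t"
    unfolding Zsep_def
  proof (rule SUP_mono)
    fix E assume "E \<in> {E. finite E \<and> separated X \<phi> \<epsilon> t E}"
    then show "\<exists>E'\<in>{E. separated X \<phi> \<epsilon> t E}. sum ?w E \<le> infsum ?w E'"
      by (intro bexI[of _ E]) auto
  qed
qed

lemma Zsep_mono: "\<epsilon> \<le> \<epsilon>' \<Longrightarrow> Zsep X \<phi> f \<epsilon>' t \<le> Zsep X \<phi> f \<epsilon> t"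
  unfolding Zsep_def by (rule SUP_subset_mono) (auto intro: separated_mono)

lemma T_Zsep_le_Zsep: "T_Zsep X \<phi> A T f \<delta> \<epsilon> t \<le> Zsep X \<phi> f \<epsilon> t"
  unfolding T_Zsep_def Zsep_eq_SUP_finite
  by (rule SUP_subset_mono) (auto intro: T_separated_imp_separated)

section \<open>Small time shifts and gaps between the times of \<open>T\<close>\<close>

text \<open>The domain \<open>{0..} \<times> X\<close> need not be compact, but the semigroup law
  reduces the times \<open>s \<le> s'\<close> at \<open>x\<close> to the times \<open>0\<close> and
  \<open>s' - s\<close> at \<open>\<phi> s x\<close>, so uniform continuity on
  \<open>{0..1} \<times> X\<close> suffices.\<close>

lemma semiflow_small_time:
  assumes "compact X" "continuous_semiflow X \<phi>" "0 < \<epsilon>"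
  obtains \<rho> where "0 < \<rho>"
    "\<And>s s' x. x \<in> X \<Longrightarrow> 0 \<le> s \<Longrightarrow> 0 \<le> s' \<Longrightarrow> \<bar>s - s'\<bar> < \<rho> \<Longrightarrow> dist (\<phi> s x) (\<phi> s' x) < \<epsilon>"
proof -
  let ?g = "\<lambda>(t, x). \<phi> t x"
  have cont: "continuous_on ({0..} \<times> X) ?g"
    and inX: "\<And>t x. 0 \<le> t \<Longrightarrow> x \<in> X \<Longrightarrow> \<phi> t x \<in> X"
    and zero: "\<And>x. x \<in> X \<Longrightarrow> \<phi> 0 x = x"
    and add: "\<And>s t x. 0 \<le> s \<Longrightarrow> 0 \<le> t \<Longrightarrow> x \<in> X \<Longrightarrow> \<phi> (s + t) x = \<phi> s (\<phi> t x)"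
    using assms(2) unfolding continuous_semiflow_def by auto
  have "uniformly_continuous_on ({0..1} \<times> X) ?g"
    by (intro compact_uniformly_continuous compact_Times assms(1))
      (auto intro: continuous_on_subset[OF cont])
  then obtain d where d: "0 < d"
    "\<And>p q. p \<in> {0..1} \<times> X \<Longrightarrow> q \<in> {0..1} \<times> X \<Longrightarrow> dist q p < d \<Longrightarrow> dist (?g q) (?g p) < \<epsilon>"
    using assms(3) unfolding uniformly_continuous_on_def by metis
  \<comment> \<open>The bound \<open>1\<close> keeps \<open>(u, x)\<close> in the compact strip; its
    distance to \<open>(0, x)\<close> is \<open>u\<close>.\<close>
  have small: "dist (\<phi> u x) x < \<epsilon>" if "x \<in> X" "0 \<le> u" "u < min d 1" for u x
    using d(2)[of "(0, x)" "(u, x)"] that zero by (auto simp: dist_Pair_Pair)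
  have le: "dist (\<phi> s' x) (\<phi> s x) < \<epsilon>"
    if "x \<in> X" "0 \<le> s" "s \<le> s'" "s' - s < min d 1" for s s' x
    using small[of "\<phi> s x" "s' - s"] add[of "s' - s" s x] inX that by auto
  show ?thesis
  proof (rule that[of "min d 1"])
    fix s s' x assume "x \<in> X" "0 \<le> s" "0 \<le> s'" "\<bar>s - s'\<bar> < min d 1"
    then show "dist (\<phi> s x) (\<phi> s' x) < \<epsilon>"
      using le[of x s s'] le[of x s' s] by (cases "s \<le> s'") (auto simp: dist_commute)
  qed (use d(1) in auto)
qed

text \<open>Admissibility bounds consecutive gaps. Induction on the larger index extends this to all
  pairs, since \<open>A x\<close> is an initial segment and contains every intermediate
  index.\<close>

lemma admissible_gap:
  assumes "admissible X \<phi> A T"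
  obtains \<eta> where "0 < \<eta>"
    "\<And>x i j. x \<in> X \<Longrightarrow> i \<in> A x \<Longrightarrow> j \<in> A x \<Longrightarrow> i < j \<Longrightarrow> T x i + \<eta> \<le> T x j"
    "\<And>x j. x \<in> X \<Longrightarrow> j \<in> A x \<Longrightarrow> 0 \<le> T x j"
proof -
  obtain \<eta> where \<eta>: "0 < \<eta>"
    and step: "\<And>x n. x \<in> X \<Longrightarrow> n \<ge> 1 \<Longrightarrow> n + 1 \<in> A x \<Longrightarrow> T x (n + 1) - T x n \<ge> \<eta>"
    using assms unfolding admissible_def by blast
  have interval: "1 \<le> k \<and> {1..k} \<subseteq> A x" if "x \<in> X" "k \<in> A x" for x k
  proof -
    have "A x = {1..} \<or> (\<exists>l\<ge>1. A x = {1..l})"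
      using assms that(1) unfolding admissible_def by blast
    then show ?thesis
      using that(2) by (elim disjE exE conjE) auto
  qed
  have "T x i + \<eta> \<le> T x j" if x: "x \<in> X" and i: "i \<in> A x" and "j \<in> A x" "i < j" for x i j
    using \<open>i < j\<close> \<open>j \<in> A x\<close>
  proof (induction j)
    case (Suc j)
    have j: "j \<ge> 1" "j \<in> A x"
      using interval[OF x i] interval[OF x Suc.prems(2)] Suc.prems(1) by auto
    have "T x j + \<eta> \<le> T x (Suc j)"
      using step[OF x j(1)] Suc.prems by simp
    moreover have "i = j \<or> T x i + \<eta> \<le> T x j"
      using Suc j(2) by (auto simp: less_Suc_eq)
    ultimately show ?case
      using \<eta> by auto
  qed simp
  moreover have "0 \<le> T x j" if "x \<in> X" "j \<in> A x" for x j
    using assms that unfolding admissible_def by blast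
  ultimately show ?thesis
    using that \<eta> by blast
qed

lemma J_set_near:
  assumes gap: "\<And>i j. i \<in> A x \<Longrightarrow> j \<in> A x \<Longrightarrow> i < j \<Longrightarrow> T x i + \<eta> \<le> T x j"
    and nonneg: "\<And>j. j \<in> A x \<Longrightarrow> 0 \<le> T x j"
    and "0 < \<delta>" "2 * \<delta> \<le> \<eta>" "2 * \<delta> \<le> t" "s \<in> {0..t}"
  obtains s' where "s' \<in> J_set A T \<delta> t x" "\<bar>s - s'\<bar> < 2 * \<delta>"
proof (cases "s \<in> J_set A T \<delta> t x")
  case True
  then show ?thesis using that[of s] \<open>0 < \<delta>\<close> by auto
next
  case False
  then obtain j where j: "j \<in> A x" "T x j - \<delta> < s" "s < T x j + \<delta>"
    using \<open>s \<in> {0..t}\<close> by (auto simp: J_set_def)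
  \<comment> \<open>The removed intervals are open and, by \<open>2 * \<delta> \<le> \<eta>\<close>,
    can touch but not overlap, so none of them contains an endpoint of another or of itself.\<close>
  have avoid: "r \<in> J_set A T \<delta> t x"
    if "r \<in> {0..t}" "r = T x j - \<delta> \<or> r = T x j + \<delta>" for r
  proof -
    have "r \<notin> {T x i - \<delta><..<T x i + \<delta>}" if "i \<in> A x" for i
      using gap[of i j] gap[of j i] j(1) that \<open>r = _ \<or> _\<close> \<open>0 < \<delta>\<close> \<open>2 * \<delta> \<le> \<eta>\<close>
      by (cases i j rule: linorder_cases) auto
    then show ?thesis
      using that(1) by (auto simp: J_set_def)
  qed
  show ?thesis
  \<comment> \<open>The left endpoint lies before \<open>s\<close>, hence before \<open>t\<close>;
    it serves whenever it is nonnegative.\<close>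
  proof (cases "\<delta> \<le> T x j")
    case True
    then show ?thesis
      using that[of "T x j - \<delta>"] avoid[of "T x j - \<delta>"] j \<open>s \<in> {0..t}\<close> by auto
  next
    \<comment> \<open>This occurs for a time of \<open>T\<close> close to \<open>0\<close>. The
      right endpoint is then below \<open>2 * \<delta>\<close>, hence at most
      \<open>t\<close>.\<close>
    case False
    then show ?thesis
      using that[of "T x j + \<delta>"] avoid[of "T x j + \<delta>"] j nonneg[OF j(1)] \<open>2 * \<delta> \<le> t\<close> \<open>s \<in> {0..t}\<close>
      by auto
  qed
qed

lemma Zsep_le_T_Zsep:
  assumes "compact X" "continuous_semiflow X \<phi>" "admissible X \<phi> A T" "0 < \<epsilon>"
  obtains \<delta> where "0 < \<delta>"
    "\<And>t. 2 * \<delta> \<le> t \<Longrightarrow> Zsep X \<phi> f \<epsilon> t \<le> T_Zsep X \<phi> A T f \<delta> (\<epsilon> / 2) t"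
proof -
  obtain \<eta> where \<eta>: "0 < \<eta>"
    "\<And>x i j. x \<in> X \<Longrightarrow> i \<in> A x \<Longrightarrow> j \<in> A x \<Longrightarrow> i < j \<Longrightarrow> T x i + \<eta> \<le> T x j"
    "\<And>x j. x \<in> X \<Longrightarrow> j \<in> A x \<Longrightarrow> 0 \<le> T x j"
    using admissible_gap[OF assms(3)] by blast
  obtain \<rho> where \<rho>: "0 < \<rho>"
    "\<And>s s' x. x \<in> X \<Longrightarrow> 0 \<le> s \<Longrightarrow> 0 \<le> s' \<Longrightarrow> \<bar>s - s'\<bar> < \<rho> \<Longrightarrow> dist (\<phi> s x) (\<phi> s' x) < \<epsilon> / 4"
    using semiflow_small_time[OF assms(1,2), of "\<epsilon> / 4"] assms(4)
    by (metis divide_pos_pos zero_less_numeral)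
  \<comment> \<open>Halving makes \<open>2 * \<delta>\<close> serve both as a bound for the interval
    length by \<open>\<eta>\<close> and as an admissible time shift for
    \<open>\<rho>\<close>.\<close>
  define \<delta> where "\<delta> = min \<eta> \<rho> / 2"
  have \<delta>: "0 < \<delta>" "2 * \<delta> \<le> \<eta>" "2 * \<delta> \<le> \<rho>"
    using \<eta>(1) \<rho>(1) by (auto simp: \<delta>_def)
  have "T_separated X \<phi> A T \<delta> (\<epsilon> / 2) t E" if t: "2 * \<delta> \<le> t" and E: "separated X \<phi> \<epsilon> t E" for t E
    unfolding T_separated_def
  proof (intro conjI ballI impI)
    show "E \<subseteq> X"
      using E by (auto simp: separated_def)
    fix x y assume "x \<in> E" "y \<in> E" "x \<noteq> y"
    then have X: "x \<in> X" "y \<in> X"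
      using \<open>E \<subseteq> X\<close> by auto
    obtain s where s: "s \<in> {0..t}" "\<epsilon> < dist (\<phi> s x) (\<phi> s y)"
      using E \<open>x \<in> E\<close> \<open>y \<in> E\<close> \<open>x \<noteq> y\<close> unfolding separated_def by blast
    \<comment> \<open>The new time is chosen from \<open>x\<close> alone; since
      \<open>\<rho>\<close> is uniform on \<open>X\<close>, the shift is harmless for
      \<open>y\<close> too, which settles the asymmetry of the separation condition.\<close>
    obtain s' where s': "s' \<in> J_set A T \<delta> t x" "\<bar>s - s'\<bar> < 2 * \<delta>"
      using J_set_near[of A x T, OF \<eta>(2,3)[OF X(1)] \<delta>(1,2) t s(1)] by blast
    have "0 \<le> s'"
      using J_set_subset[of A T \<delta> t x] s'(1) by auto
    then have "dist (\<phi> s x) (\<phi> s' x) < \<epsilon> / 4" "dist (\<phi> s y) (\<phi> s' y) < \<epsilon> / 4"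
      using \<rho>(2) X s(1) s'(2) \<delta>(3) by auto
    moreover have "dist (\<phi> s x) (\<phi> s y)
        \<le> dist (\<phi> s x) (\<phi> s' x) + dist (\<phi> s' x) (\<phi> s' y) + dist (\<phi> s y) (\<phi> s' y)"
      by metric
    ultimately show "\<exists>s\<in>J_set A T \<delta> t x. \<epsilon> / 2 < dist (\<phi> s x) (\<phi> s y)"
      using s(2) s'(1) by (intro bexI[of _ s']) auto
  qed
  then have "Zsep X \<phi> f \<epsilon> t \<le> T_Zsep X \<phi> A T f \<delta> (\<epsilon> / 2) t" if "2 * \<delta> \<le> t" for t
    unfolding T_Zsep_def Zsep_eq_SUP_finite
    using that by (intro SUP_subset_mono) auto
  then show ?thesis
    using that \<delta>(1) by blast
qed

section \<open>Pressures as suprema, and their equality\<close>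

lemma pressure_eq_SUP: "pressure X \<phi> f = (SUP \<epsilon>\<in>{0<..}. pressure_eps X \<phi> f \<epsilon>)"
  unfolding pressure_def pressure_eps_def
  by (intro Lim_at_right_0_SUP Limsup_growth_mono Zsep_mono)

lemma T_pressure_delta_eq_SUP:
  "T_pressure_delta X \<phi> A T f \<delta> = (SUP \<epsilon>\<in>{0<..}. T_pressure_delta_eps X \<phi> A T f \<delta> \<epsilon>)"
  unfolding T_pressure_delta_def T_pressure_delta_eps_def
  by (intro Lim_at_right_0_SUP Limsup_growth_mono T_Zsep_mono) auto

lemma T_pressure_eq_SUP:
  "T_pressure X \<phi> A T f =
     (SUP \<delta>\<in>{0<..}. SUP \<epsilon>\<in>{0<..}. T_pressure_delta_eps X \<phi> A T f \<delta> \<epsilon>)"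
  unfolding T_pressure_def T_pressure_delta_eq_SUP unfolding T_pressure_delta_eps_def
  by (intro Lim_at_right_0_SUP SUP_mono' Limsup_growth_mono T_Zsep_mono) auto

theorem theorem2:
  fixes X :: "'a::metric_space set"
    and \<phi> :: "real \<Rightarrow> 'a \<Rightarrow> 'a"
    and A :: "'a \<Rightarrow> nat set"
    and T :: "'a \<Rightarrow> nat \<Rightarrow> real"
    and f :: "'a \<Rightarrow> real"
  assumes "compact X"
    and "continuous_semiflow X \<phi>"
    and "admissible X \<phi> A T"
    and "continuous_on X f"
  shows "T_pressure X \<phi> A T f = pressure X \<phi> f"
proof (rule antisym)
  show "T_pressure X \<phi> A T f \<le> pressure X \<phi> f"
    unfolding T_pressure_eq_SUP pressure_eq_SUP T_pressure_delta_eps_def pressure_eps_def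
    by (intro SUP_least SUP_mono' Limsup_growth_mono T_Zsep_le_Zsep)
  show "pressure X \<phi> f \<le> T_pressure X \<phi> A T f"
    unfolding pressure_eq_SUP T_pressure_eq_SUP
  proof (rule SUP_least)
    fix \<epsilon> :: real assume "\<epsilon> \<in> {0<..}"
    then have "0 < \<epsilon>" by simp
    obtain \<delta> where \<delta>: "0 < \<delta>"
      "\<And>t. 2 * \<delta> \<le> t \<Longrightarrow> Zsep X \<phi> f \<epsilon> t \<le> T_Zsep X \<phi> A T f \<delta> (\<epsilon> / 2) t"
      using Zsep_le_T_Zsep[OF assms(1-3) \<open>0 < \<epsilon>\<close>] by blast
    then have "pressure_eps X \<phi> f \<epsilon> \<le> T_pressure_delta_eps X \<phi> A T f \<delta> (\<epsilon> / 2)"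
      unfolding pressure_eps_def T_pressure_delta_eps_def by (intro Limsup_growth_mono)
    \<comment> \<open>Although \<delta> depends on \<epsilon>, the pair \<open>\<delta>\<close>,
      \<open>\<epsilon> / 2\<close> is among those of the double supremum, which absorbs both this
      dependence and the halving.\<close>
    then show "pressure_eps X \<phi> f \<epsilon>
        \<le> (SUP \<delta>\<in>{0<..}. SUP \<epsilon>\<in>{0<..}. T_pressure_delta_eps X \<phi> A T f \<delta> \<epsilon>)"
      using \<delta>(1) \<open>0 < \<epsilon>\<close>
      by (intro SUP_upper2[of \<delta>] SUP_upper2[of "\<epsilon> / 2"]) auto
  qed
qed

end
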